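(* For homogeneous ideals $I$ of $\mathbb{K}[\mathbb{P}^2]$ and positive integers $m,r$, the bound $m/r\ge 2$ for the containment $I^{(m)}\subseteq I^r$ is optimal; that is, there is no real number $c<2$ such that for every nontrivial homogeneous ideal $I$ of $\mathbb{K}[\mathbb{P}^2]$ and all positive integers $m,r$ with $m/r\ge c$ the containment $I^{(m)}\subseteq I^r$ holds.
   Context: $\mathbb{K}$ is an algebraically closed field and $R=\mathbb{K}[\mathbb{P}^2]=\mathbb{K}[x_0,x_1,x_2]$ is the coordinate ring of the projective plane over $\mathbb{K}$. For a nontrivial homogeneous ideal $I\subset R$ and a positive integer $m$, the symbolic power is $I^{(m)}=R\cap I^mR_U$, where $U=R-\bigcup_{P\in\mathrm{Ass}(I)}P$; $I^r$ is the ordinary power. *)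

theory Defs
  imports
    "HOL-Algebra.Ideal_Product"
    "HOL-Algebra.Algebraic_Closure_Type"
    "HOL-Library.Poly_Mapping"
    "HOL-Library.Numeral_Type"
    "HOL-Computational_Algebra.Polynomial_Factorial"
begin

text \<open>The coordinate ring \<open>K[x\<^sub>0, x\<^sub>1, x\<^sub>2]\<close> of the projective plane over \<open>'k\<close>:
  a monomial is an exponent vector indexed by the three-element type \<open>3\<close>, a polynomial is a
  finitely supported map from monomials to coefficients, and multiplication is convolution.\<close>

type_synonym 'k plane_coord = "(3 \<Rightarrow>\<^sub>0 nat) \<Rightarrow>\<^sub>0 'k"

definition total_degree :: "(3 \<Rightarrow>\<^sub>0 nat) \<Rightarrow> nat" where
  "total_degree t = (\<Sum>i\<in>UNIV. Poly_Mapping.lookup t i)"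

text \<open>The zero polynomial counts as homogeneous (of every degree).\<close>

definition homogeneous_poly :: "'k::field plane_coord \<Rightarrow> bool" where
  "homogeneous_poly f \<longleftrightarrow> (\<exists>d. \<forall>t\<in>Poly_Mapping.keys f. total_degree t = d)"

definition homogeneous_ideal :: "'k::field plane_coord set \<Rightarrow> bool" where
  "homogeneous_ideal I \<longleftrightarrow>
     (\<exists>S. (\<forall>f\<in>S. homogeneous_poly f) \<and> I = Idl\<^bsub>ring_of_type_algebra\<^esub> S)"

text \<open>The monoid \<open>ideals_set\<close> has the ideal product as multiplication and the unit ideal as one.\<close>

definition ideal_power :: "'a::comm_ring_1 set \<Rightarrow> nat \<Rightarrow> 'a set" where
  "ideal_power I n = I [^]\<^bsub>ideals_set ring_of_type_algebra\<^esub> n"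

text \<open>The prime ideals that are annihilators \<open>(I : f)\<close> of a class \<open>f + I\<close> in the
  quotient by \<open>I\<close>.\<close>

definition associated_primes :: "'a::comm_ring_1 set \<Rightarrow> 'a set set" where
  "associated_primes I =
     {P. primeideal P ring_of_type_algebra \<and> (\<exists>f. P = {g. g * f \<in> I})}"

text \<open>The localization of a domain at a multiplicative set \<open>U\<close> with \<open>0 \<notin> U\<close>, as a subring
  of its fraction field.\<close>

definition localization :: "'a::idom set \<Rightarrow> 'a fract ring" where
  "localization U = ring_of_type_algebra \<lparr>carrier := {Fraction_Field.Fract a u | a u. u \<in> U}\<rparr>"

text \<open>\<open>I\<^sup>(\<^sup>m\<^sup>) = R \<inter> I\<^sup>m R\<^sub>U\<close> with \<open>U\<close> the complement of the union of the associated primes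
  of \<open>I\<close>; here \<open>I\<^sup>m R\<^sub>U\<close> is the ideal of \<open>R\<^sub>U\<close> generated by the image of \<open>I\<^sup>m\<close>, and the
  intersection with \<open>R\<close> is the preimage under \<open>to_fract\<close>. For a proper ideal \<open>I\<close> of a Noetherian
  domain there is an associated prime, so that \<open>0 \<notin> U\<close>.\<close>

definition symbolic_power :: "'a::idom set \<Rightarrow> nat \<Rightarrow> 'a set" where
  "symbolic_power I m =
     (let U = UNIV - \<Union>(associated_primes I)
      in {f. to_fract f \<in> Idl\<^bsub>localization U\<^esub> (to_fract ` ideal_power I m)})"

end

theory Submission
  imports Defs
begin

text \<open>
  The bound 2 is approached by star configurations. Take \<open>s\<close> lines \<open>L\<^sub>1, \<dots>, L\<^sub>s\<close> in the plane, no three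
  of them concurrent, and let \<open>I\<close> be the ideal generated by the \<open>s\<close> products \<open>P\<^sub>i\<close> of all lines but
  \<open>L\<^sub>i\<close>. It is the ideal of the pairwise intersection points. The product \<open>F\<close> of all lines passes
  twice through each of these points, so \<open>F\<^sup>k\<close> lies in the symbolic power of exponent \<open>2 k\<close>. But \<open>F\<^sup>k\<close>
  has degree \<open>k s\<close>, and the elements of \<open>I\<^sup>r\<close> have order at least \<open>r (s - 1)\<close>. For \<open>r = s\<close> and
  \<open>k = s - 2\<close> this excludes \<open>F\<^sup>k\<close> from \<open>I\<^sup>r\<close>, and \<open>m / r = 2 k / r = 2 - 4 / s\<close> tends to 2.

  Membership in the symbolic power is witnessed by a single denominator. Let \<open>u\<close> be the sum, over all
  pairs of lines, of the product of the remaining \<open>s - 2\<close> lines. Since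
  \<open>P\<^sub>i P\<^sub>j = F \<cdot> F / (L\<^sub>i L\<^sub>j)\<close>, the product \<open>u F\<close> lies in \<open>I\<^sup>2\<close>
  (\<open>pair_omitting_sum_mult_prod_power\<close>). Moreover \<open>u\<close> is a nonzerodivisor modulo \<open>I\<close>
  (\<open>pair_omitting_sum_regular\<close>): modulo \<open>(L\<^sub>i, L\<^sub>j)\<close> it is a product of lines missing the point, so it can
  be cancelled there, and \<open>I\<close> is the intersection of the ideals \<open>(L\<^sub>i, L\<^sub>j)\<close>
  (\<open>in_star_ideal_if_in_point_ideals\<close>). A nonzerodivisor avoids every associated prime, which is what a
  denominator has to do (\<open>mult_in_symbolic_powerI\<close>).

  All of this is formal once any line can be cancelled modulo the ideal of the intersection point of two
  others. An algebraically closed field is infinite, so arbitrarily many points lie on a conic, and for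
  the lines dual to them the cancellation is an explicit substitution (\<open>moment_line_regular\<close>).
\<close>

section \<open>Ideals, ideal powers and symbolic powers\<close>

lemma ideal_type_iff:
  "ideal I (ring_of_type_algebra :: 'a::comm_ring_1 ring) \<longleftrightarrow>
     0 \<in> I \<and> (\<forall>x\<in>I. \<forall>y\<in>I. x + y \<in> I) \<and> (\<forall>a. \<forall>x\<in>I. a * x \<in> I)"
  (is "?L \<longleftrightarrow> ?R")
proof
  assume ?L
  interpret I: ideal I ring_of_type_algebra by fact
  show ?R
    using additive_subgroup.zero_closed[OF I.additive_subgroup_axioms]
      additive_subgroup.a_closed[OF I.additive_subgroup_axioms] I.I_l_closed
    by (simp add: ring_of_type_algebra_def)
next
  assume R: ?R
  have neg: "- x \<in> I" if "x \<in> I" for x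
    using R that by (metis mult_minus1)
  show ?L
  proof (rule idealI)
    show "Ring.ring (ring_of_type_algebra :: 'a ring)" by (rule ring_from_type_algebra)
    show "subgroup I (add_monoid ring_of_type_algebra)"
    proof (rule group.subgroupI)
      show "Group.group (add_monoid (ring_of_type_algebra :: 'a ring))"
        using ring_from_type_algebra by (meson abelian_group.a_group ring_def)
      fix x assume x: "x \<in> I"
      have "inv\<^bsub>add_monoid ring_of_type_algebra\<^esub> x = - x"
      proof (rule group.inv_equality)
        show "Group.group (add_monoid (ring_of_type_algebra :: 'a ring))"
          using ring_from_type_algebra by (meson abelian_group.a_group ring_def)
      qed (auto simp: ring_of_type_algebra_def)
      thus "inv\<^bsub>add_monoid ring_of_type_algebra\<^esub> x \<in> I" using neg x by simp
    qed (use R in \<open>auto simp: ring_of_type_algebra_def\<close>)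
  next
    fix a x assume "a \<in> I"
    thus "x \<otimes>\<^bsub>ring_of_type_algebra\<^esub> a \<in> I" "a \<otimes>\<^bsub>ring_of_type_algebra\<^esub> x \<in> I"
      using R by (simp_all add: ring_of_type_algebra_def mult.commute[of a x])
  qed
qed

lemma genideal_finite_family:
  fixes P :: "'i \<Rightarrow> 'a::comm_ring_1"
  assumes "finite S"
  shows "Idl\<^bsub>ring_of_type_algebra\<^esub> (P ` S) = {\<Sum>i\<in>S. g i * P i | g. True}" (is "?L = ?R")
proof
  have "ideal ?R ring_of_type_algebra"
    unfolding ideal_type_iff
  proof (intro conjI ballI allI)
    show "0 \<in> ?R" by (auto intro!: exI[of _ "\<lambda>_. 0"])
  next
    fix x y assume "x \<in> ?R" "y \<in> ?R"
    then obtain g h where "x = (\<Sum>i\<in>S. g i * P i)" "y = (\<Sum>i\<in>S. h i * P i)" by auto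
    hence "x + y = (\<Sum>i\<in>S. (g i + h i) * P i)" by (simp add: sum.distrib distrib_right)
    thus "x + y \<in> ?R" by (auto intro!: exI[of _ "\<lambda>i. g i + h i"])
  next
    fix a x assume "x \<in> ?R"
    then obtain g where "x = (\<Sum>i\<in>S. g i * P i)" by auto
    hence "a * x = (\<Sum>i\<in>S. (a * g i) * P i)" by (simp add: sum_distrib_left mult.assoc)
    thus "a * x \<in> ?R" by (auto intro!: exI[of _ "\<lambda>i. a * g i"])
  qed
  moreover have "P ` S \<subseteq> ?R"
  proof
    fix x assume "x \<in> P ` S"
    then obtain i where "i \<in> S" "x = P i" by auto
    hence "x = (\<Sum>j\<in>S. (if j = i then 1 else 0) * P j)"
      using assms by (simp add: if_distrib[of "\<lambda>c. c * _"] sum.delta' cong: if_cong)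
    thus "x \<in> ?R" by (auto intro!: exI[of _ "\<lambda>j. if j = i then 1 else 0"])
  qed
  ultimately show "?L \<subseteq> ?R" unfolding genideal_def by blast
  show "?R \<subseteq> ?L"
  proof
    fix x assume "x \<in> ?R"
    then obtain g where x: "x = (\<Sum>i\<in>S. g i * P i)" by auto
    show "x \<in> ?L" unfolding genideal_def
    proof
      fix J assume "J \<in> {J. ideal J ring_of_type_algebra \<and> P ` S \<subseteq> J}"
      hence J: "0 \<in> J" "\<And>x y. x \<in> J \<Longrightarrow> y \<in> J \<Longrightarrow> x + y \<in> J" "\<And>a x. x \<in> J \<Longrightarrow> a * x \<in> J"
        and PJ: "\<And>i. i \<in> S \<Longrightarrow> P i \<in> J"
        by (auto simp: ideal_type_iff)
      show "x \<in> J"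
        unfolding x using assms PJ by (induction S rule: finite_induct) (auto intro!: J)
    qed
  qed
qed

lemma ideal_power_0: "ideal_power I 0 = (UNIV :: 'a::comm_ring_1 set)"
  by (simp add: ideal_power_def nat_pow_def ideals_set_def ring_of_type_algebra_def)

lemma ideal_power_Suc:
  "ideal_power I (Suc n) = ideal_prod ring_of_type_algebra (ideal_power I n) (I :: 'a::comm_ring_1 set)"
  by (simp add: ideal_power_def nat_pow_def ideals_set_def)

lemma mult_in_ideal_power_Suc:
  "x \<in> ideal_power I n \<Longrightarrow> y \<in> I \<Longrightarrow> x * y \<in> ideal_power (I :: 'a::comm_ring_1 set) (Suc n)"
  using ideal_prod.prod[of x "ideal_power I n" y I ring_of_type_algebra]
  by (simp add: ideal_power_Suc ring_of_type_algebra_def)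

lemma add_in_ideal_power_Suc:
  "x \<in> ideal_power I (Suc n) \<Longrightarrow> y \<in> ideal_power I (Suc n) \<Longrightarrow>
     x + y \<in> ideal_power (I :: 'a::comm_ring_1 set) (Suc n)"
  using ideal_prod.sum[of x ring_of_type_algebra "ideal_power I n" I y]
  by (simp add: ideal_power_Suc ring_of_type_algebra_def)

text \<open>Bounds an ideal power from above by a multiplicative filtration \<open>D\<close>. For the filtration by the
order of vanishing at the origin this keeps polynomials of low degree out of the ideal power.\<close>

lemma ideal_power_order_subset:
  fixes I :: "'a::comm_ring_1 set"
  assumes "I \<subseteq> D d" and "D 0 = UNIV"
    and "\<And>n x y. x \<in> D n \<Longrightarrow> y \<in> D n \<Longrightarrow> x + y \<in> D n"
    and "\<And>m n x y. x \<in> D m \<Longrightarrow> y \<in> D n \<Longrightarrow> x * y \<in> D (m + n)"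
  shows "ideal_power I r \<subseteq> D (r * d)"
proof (induction r)
  case (Suc r)
  show ?case
  proof
    fix x assume "x \<in> ideal_power I (Suc r)"
    thus "x \<in> D (Suc r * d)"
      unfolding ideal_power_Suc
    proof (induction rule: ideal_prod.induct)
      case (prod i j)
      thus ?case using assms(1) assms(4)[of i "r * d" j d] Suc
        by (auto simp: ring_of_type_algebra_def add.commute)
    next
      case (sum s1 s2)
      thus ?case using assms(3) by (simp add: ring_of_type_algebra_def)
    qed
  qed
qed (use assms in simp)

text \<open>No associated primes have to be computed: a nonzerodivisor \<open>u\<close> modulo \<open>I\<close> lies in none of them,
since \<open>u \<in> (I : f)\<close> forces \<open>f \<in> I\<close> and then \<open>(I : f)\<close> is the whole ring. So \<open>u\<close> is invertible in
the localization, and multiplying \<open>u f\<close> by its inverse gives \<open>f\<close>.\<close>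

lemma mult_in_symbolic_powerI:
  fixes I :: "'a::idom set"
  assumes proper: "1 \<notin> I" and zero: "0 \<in> I"
    and regular: "\<And>g. u * g \<in> I \<Longrightarrow> g \<in> I"
    and uf: "u * f \<in> ideal_power I m"
  shows "f \<in> symbolic_power I m"
proof -
  define U where "U = UNIV - \<Union>(associated_primes I)"
  have u: "u \<in> U"
  proof (rule ccontr)
    assume "u \<notin> U"
    then obtain P f where P: "primeideal P ring_of_type_algebra" "P = {g. g * f \<in> I}" "u \<in> P"
      by (auto simp: U_def associated_primes_def)
    hence "f \<in> I" using regular by auto
    moreover have "ideal P ring_of_type_algebra" using P(1) primeideal.axioms(1) by blast
    ultimately have "1 \<in> P" using P(2) by simp
    hence "P = UNIV" using \<open>ideal P ring_of_type_algebra\<close> by (metis UNIV_eq_I ideal_type_iff mult.right_neutral)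
    thus False using primeideal.I_notcarr[OF P(1)] by (simp add: ring_of_type_algebra_def)
  qed
  have "u \<noteq> 0" using regular[of 1] proper zero by auto
  hence f: "to_fract f = Fraction_Field.Fract 1 u * to_fract (u * f)"
    by (simp add: to_fract_def eq_fract)
  have "to_fract f \<in> Idl\<^bsub>localization U\<^esub> (to_fract ` ideal_power I m)"
    unfolding genideal_def
  proof
    fix J assume "J \<in> {J. ideal J (localization U) \<and> to_fract ` ideal_power I m \<subseteq> J}"
    hence "ideal J (localization U)" and "to_fract (u * f) \<in> J" using uf by auto
    moreover have "Fraction_Field.Fract 1 u \<in> carrier (localization U)"
      using u by (auto simp: localization_def)
    ultimately have "Fraction_Field.Fract 1 u \<otimes>\<^bsub>localization U\<^esub> to_fract (u * f) \<in> J"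
      by (simp add: ideal.I_l_closed)
    thus "to_fract f \<in> J"
      unfolding f by (simp add: localization_def ring_of_type_algebra_def)
  qed
  thus ?thesis by (simp add: symbolic_power_def Let_def U_def)
qed

section \<open>The ideal of a star configuration\<close>

definition pair_ideal :: "'a::comm_ring_1 \<Rightarrow> 'a \<Rightarrow> 'a set" where
  "pair_ideal a b = {p * a + q * b | p q. True}"

lemma pair_ideal_add: "x \<in> pair_ideal a b \<Longrightarrow> y \<in> pair_ideal a b \<Longrightarrow> x + y \<in> pair_ideal a b"
proof -
  assume "x \<in> pair_ideal a b" "y \<in> pair_ideal a b"
  then obtain p q p' q' where "x = p * a + q * b" "y = p' * a + q' * b" by (auto simp: pair_ideal_def)
  hence "x + y = (p + p') * a + (q + q') * b" by (simp add: algebra_simps)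
  thus ?thesis unfolding pair_ideal_def by blast
qed

lemma pair_ideal_mult: "x \<in> pair_ideal a b \<Longrightarrow> c * x \<in> pair_ideal a b"
proof -
  assume "x \<in> pair_ideal a b"
  then obtain p q where "x = p * a + q * b" by (auto simp: pair_ideal_def)
  hence "c * x = (c * p) * a + (c * q) * b" by (simp add: algebra_simps)
  thus ?thesis unfolding pair_ideal_def by blast
qed

lemma pair_ideal_dvd1: "a dvd x \<Longrightarrow> x \<in> pair_ideal a b"
proof -
  assume "a dvd x"
  then obtain p where "x = a * p" by (rule dvdE)
  hence "x = p * a + 0 * b" by (simp add: mult.commute)
  thus ?thesis unfolding pair_ideal_def by blast
qed

lemma pair_ideal_dvd2: "b dvd x \<Longrightarrow> x \<in> pair_ideal a b"
proof -
  assume "b dvd x"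
  then obtain q where "x = b * q" by (rule dvdE)
  hence "x = 0 * a + q * b" by (simp add: mult.commute)
  thus ?thesis unfolding pair_ideal_def by blast
qed

lemma pair_ideal_0: "0 \<in> pair_ideal a b"
  by (rule pair_ideal_dvd1) simp

lemma pair_ideal_diff: "x \<in> pair_ideal a b \<Longrightarrow> y \<in> pair_ideal a b \<Longrightarrow> x - y \<in> pair_ideal a b"
  using pair_ideal_add[of x a b "- 1 * y"] pair_ideal_mult[of y a b "- 1"] by simp

lemma pair_ideal_sum: "(\<And>i. i \<in> S \<Longrightarrow> f i \<in> pair_ideal a b) \<Longrightarrow> sum f S \<in> pair_ideal a b"
  by (induction S rule: infinite_finite_induct) (auto intro: pair_ideal_add pair_ideal_0)

text \<open>For linear forms \<open>L i\<close> in three variables this says that no line passes through the intersection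
point of two others. It is stated without primality of the ideal of that point, because
cancelling one form at a time is all that the arguments below do with it.\<close>

definition points_regular :: "('i \<Rightarrow> 'a::comm_ring_1) \<Rightarrow> 'i set \<Rightarrow> bool" where
  "points_regular L S \<longleftrightarrow> (\<forall>i\<in>S. \<forall>j\<in>S. \<forall>k\<in>S. \<forall>g. i \<noteq> j \<and> i \<noteq> k \<and> j \<noteq> k \<longrightarrow>
     L k * g \<in> pair_ideal (L i) (L j) \<longrightarrow> g \<in> pair_ideal (L i) (L j))"

text \<open>The products that omit one form generate the ideal of all pairwise intersection points, the star
configuration of the lines \<open>L i\<close>.\<close>

definition star_ideal :: "('i \<Rightarrow> 'a::comm_ring_1) \<Rightarrow> 'i set \<Rightarrow> 'a set" where
  "star_ideal L S = {\<Sum>i\<in>S. g i * (\<Prod>j\<in>S - {i}. L j) | g. True}"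

lemma points_regular_prod:
  assumes "points_regular L S" "finite T" "T \<subseteq> S - {i, j}" "i \<in> S" "j \<in> S" "i \<noteq> j"
    and "(\<Prod>k\<in>T. L k) * g \<in> pair_ideal (L i) (L j)"
  shows "g \<in> pair_ideal (L i) (L j)"
  using assms(2,3,7)
proof (induction T arbitrary: g rule: finite_induct)
  case (insert k T)
  have "L k * ((\<Prod>k\<in>T. L k) * g) \<in> pair_ideal (L i) (L j)"
    using insert by (simp add: mult.assoc)
  hence "(\<Prod>k\<in>T. L k) * g \<in> pair_ideal (L i) (L j)"
    using assms(1,4-6) insert.prems(1) unfolding points_regular_def by blast
  thus ?case using insert by blast
qed simp

lemma star_ideal_subset_point:
  assumes "finite S" "i \<in> S" "j \<in> S" "i \<noteq> j"
  shows "star_ideal L S \<subseteq> pair_ideal (L i) (L j)"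
proof -
  have "g k * (\<Prod>l\<in>S - {k}. L l) \<in> pair_ideal (L i) (L j)" if "k \<in> S" for k g
  proof (cases "k = i")
    case True
    thus ?thesis using assms by (intro pair_ideal_mult pair_ideal_dvd2 dvd_prodI) auto
  next
    case False
    thus ?thesis using assms by (intro pair_ideal_mult pair_ideal_dvd1 dvd_prodI) auto
  qed
  thus ?thesis unfolding star_ideal_def by (auto intro!: pair_ideal_sum)
qed

text \<open>Together with the reverse inclusion above, the star ideal is the intersection of the ideals
\<open>(L i, L j)\<close>. The induction adds a line \<open>L m\<close>: if \<open>f = \<Sum> g i P i\<close> for the old lines and \<open>f\<close> vanishes
at the point of \<open>L i\<close> and \<open>L m\<close>, then all summands but the \<open>i\<close>-th vanish there, hence so does
\<open>g i\<close> by regularity. Writing \<open>g i = a L i + b L m\<close> turns \<open>g i P i\<close> into a combination of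
the new generators.\<close>

lemma in_star_ideal_if_in_point_ideals:
  assumes "finite S" "S \<noteq> {}" "points_regular L S"
    and "\<And>i j. i \<in> S \<Longrightarrow> j \<in> S \<Longrightarrow> i \<noteq> j \<Longrightarrow> f \<in> pair_ideal (L i) (L j)"
  shows "f \<in> star_ideal L S"
  using assms
proof (induction S rule: finite_ne_induct)
  case (singleton i)
  show ?case by (auto simp: star_ideal_def intro!: exI[of _ "\<lambda>_. f"])
next
  case (insert m S)
  have reg: "points_regular L S" using insert.prems(1) unfolding points_regular_def by blast
  obtain g where f: "f = (\<Sum>i\<in>S. g i * (\<Prod>j\<in>S - {i}. L j))"
    using insert.IH[OF reg] insert.prems(2) by (auto simp: star_ideal_def)
  have "\<exists>a b. g i = a * L i + b * L m" if i: "i \<in> S" for i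
  proof -
    have im: "i \<noteq> m" using i insert by auto
    have "g k * (\<Prod>j\<in>S - {k}. L j) \<in> pair_ideal (L i) (L m)" if "k \<in> S - {i}" for k
      using that insert i by (intro pair_ideal_mult pair_ideal_dvd1 dvd_prodI) auto
    hence "f - (\<Sum>k\<in>S - {i}. g k * (\<Prod>j\<in>S - {k}. L j)) \<in> pair_ideal (L i) (L m)"
      using insert.prems(2)[of i m] i im by (intro pair_ideal_diff pair_ideal_sum) auto
    hence "(\<Prod>j\<in>S - {i}. L j) * g i \<in> pair_ideal (L i) (L m)"
      unfolding f using i insert.hyps
      by (subst (asm) sum.remove[of S i]) (simp_all add: mult.commute[of "g i"])
    hence "g i \<in> pair_ideal (L i) (L m)"
      using insert.hyps insert.prems(1) i im
      by - (rule points_regular_prod[of L "insert m S" "S - {i}" i m], auto)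
    thus ?thesis unfolding pair_ideal_def by auto
  qed
  then obtain a b where g: "\<And>i. i \<in> S \<Longrightarrow> g i = a i * L i + b i * L m" by metis
  have "f = (\<Sum>i\<in>S. a i * (\<Prod>j\<in>S. L j) + b i * (\<Prod>j\<in>insert m S - {i}. L j))"
    unfolding f
  proof (rule sum.cong)
    fix i assume i: "i \<in> S"
    hence "insert m S - {i} = insert m (S - {i})" using insert by auto
    hence "(\<Prod>j\<in>insert m S - {i}. L j) = L m * (\<Prod>j\<in>S - {i}. L j)"
      using insert by simp
    moreover have "(\<Prod>j\<in>S. L j) = L i * (\<Prod>j\<in>S - {i}. L j)"
      using insert i by (simp add: prod.remove)
    ultimately show "g i * (\<Prod>j\<in>S - {i}. L j) =
        a i * (\<Prod>j\<in>S. L j) + b i * (\<Prod>j\<in>insert m S - {i}. L j)"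
      by (simp add: g[OF i] algebra_simps)
  qed simp
  also have "\<dots> = (\<Sum>i\<in>S. a i) * (\<Prod>j\<in>S. L j) + (\<Sum>i\<in>S. b i * (\<Prod>j\<in>insert m S - {i}. L j))"
    by (simp add: sum.distrib sum_distrib_right)
  also have "\<dots> = (\<Sum>i\<in>insert m S. (if i = m then \<Sum>i\<in>S. a i else b i) * (\<Prod>j\<in>insert m S - {i}. L j))"
  proof -
    have "insert m S - {m} = S" using insert by auto
    moreover have "(\<Sum>i\<in>S. (if i = m then \<Sum>i\<in>S. a i else b i) * (\<Prod>j\<in>insert m S - {i}. L j)) =
        (\<Sum>i\<in>S. b i * (\<Prod>j\<in>insert m S - {i}. L j))"
      using insert.hyps by (intro sum.cong) auto
    ultimately show ?thesis using insert.hyps by simp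
  qed
  finally show ?case
    unfolding star_ideal_def mem_Collect_eq
    by (intro exI[of _ "\<lambda>i. if i = m then \<Sum>i\<in>S. a i else b i"] conjI TrueI)
qed

text \<open>At the intersection point of \<open>L i\<close> and \<open>L j\<close> only the summand for \<open>A = {i, j}\<close> survives, so this
form vanishes at none of the points. Summing over two-element sets rather than ordered pairs avoids
a factor 2, which would be fatal in characteristic 2.\<close>

definition pair_omitting_sum :: "('i \<Rightarrow> 'a::comm_ring_1) \<Rightarrow> 'i set \<Rightarrow> 'a" where
  "pair_omitting_sum L S = (\<Sum>A | A \<subseteq> S \<and> card A = 2. \<Prod>j\<in>S - A. L j)"

text \<open>If \<open>u f\<close> vanishes at a point, then so does \<open>f\<close>, because \<open>u\<close> agrees there with one product of forms
that regularity cancels.\<close>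

lemma pair_omitting_sum_regular:
  assumes fin: "finite S" and ne: "S \<noteq> {}" and reg: "points_regular L S"
    and uf: "pair_omitting_sum L S * f \<in> star_ideal L S"
  shows "f \<in> star_ideal L S"
proof (rule in_star_ideal_if_in_point_ideals[OF fin ne reg])
  fix i j assume ij: "i \<in> S" "j \<in> S" "i \<noteq> j"
  let ?T = "{A. A \<subseteq> S \<and> card A = 2}"
  have T: "finite ?T" "{i, j} \<in> ?T" using fin ij by auto
  have "(\<Prod>k\<in>S - A. L k) \<in> pair_ideal (L i) (L j)" if A: "A \<in> ?T - {{i, j}}" for A
  proof -
    have "i \<notin> A \<or> j \<notin> A"
    proof (rule ccontr)
      assume "\<not> (i \<notin> A \<or> j \<notin> A)"
      moreover have "finite A" using A fin finite_subset by auto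
      ultimately have "A = {i, j}" using A ij card_subset_eq[of A "{i, j}"] by auto
      thus False using A by simp
    qed
    thus ?thesis
    proof
      assume "i \<notin> A" thus ?thesis using fin ij by (intro pair_ideal_dvd1 dvd_prodI) auto
    next
      assume "j \<notin> A" thus ?thesis using fin ij by (intro pair_ideal_dvd2 dvd_prodI) auto
    qed
  qed
  hence "pair_omitting_sum L S * f - f * (\<Sum>A\<in>?T - {{i, j}}. \<Prod>k\<in>S - A. L k) \<in> pair_ideal (L i) (L j)"
      using star_ideal_subset_point[OF fin ij, of L] uf
    by (intro pair_ideal_diff[OF _ pair_ideal_mult[OF pair_ideal_sum]]) blast+
  hence "(\<Prod>k\<in>S - {i, j}. L k) * f \<in> pair_ideal (L i) (L j)"
    unfolding pair_omitting_sum_def by (subst (asm) sum.remove[OF T]) (simp add: algebra_simps)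
  thus "f \<in> pair_ideal (L i) (L j)"
    using points_regular_prod[OF reg, of "S - {i, j}" i j f] fin ij by auto
qed

lemma pair_omitting_sum_power_regular:
  assumes "finite S" "S \<noteq> {}" "points_regular L S"
    and "pair_omitting_sum L S ^ k * f \<in> star_ideal L S"
  shows "f \<in> star_ideal L S"
  using assms(4)
proof (induction k)
  case (Suc k)
  thus ?case using pair_omitting_sum_regular[OF assms(1-3)] by (simp add: mult.assoc)
qed simp

lemma star_ideal_eq_genideal:
  "finite S \<Longrightarrow> star_ideal L S = Idl\<^bsub>ring_of_type_algebra\<^esub> ((\<lambda>i. \<Prod>j\<in>S - {i}. L j) ` S)"
  by (simp add: genideal_finite_family star_ideal_def)

lemma star_ideal_generator:
  assumes "finite S" "i \<in> S"
  shows "(\<Prod>j\<in>S - {i}. L j) \<in> star_ideal L S"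
  using assms by (auto simp: star_ideal_eq_genideal genideal_def)

text \<open>The generators that omit \<open>a\<close> and \<open>b\<close> multiply to \<open>F\<close> times the product that omits both, where
\<open>F\<close> is the product of all forms. Summing over pairs gives \<open>u F \<in> I\<^sup>2\<close>: each point lies on two of
the lines, so \<open>F\<close> vanishes twice at it.\<close>

lemma pair_omitting_sum_mult_prod_power:
  assumes "finite S"
  shows "pair_omitting_sum L S ^ k * (\<Prod>j\<in>S. L j) ^ k \<in> ideal_power (star_ideal L S) (2 * k)"
proof (induction k)
  case (Suc k)
  let ?I = "star_ideal L S" and ?T = "{A. A \<subseteq> S \<and> card A = 2}"
  define z where "z = pair_omitting_sum L S ^ k * (\<Prod>j\<in>S. L j) ^ k"
  have I0: "0 \<in> ?I" by (auto simp: star_ideal_def intro!: exI[of _ "\<lambda>_. 0"])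
  have step: "z * ((\<Prod>j\<in>S - A. L j) * (\<Prod>j\<in>S. L j)) \<in> ideal_power ?I (Suc (Suc (2 * k)))"
    if A2: "A \<in> ?T" for A
  proof -
    obtain a b where A: "A = {a, b}" "a \<noteq> b" and ab: "a \<in> S" "b \<in> S"
      using A2 unfolding mem_Collect_eq card_2_iff by blast
    have "(\<Prod>j\<in>S. L j) = L a * (\<Prod>j\<in>S - {a}. L j)"
      using assms ab(1) by (rule prod.remove)
    moreover have "(\<Prod>j\<in>S - {b}. L j) = L a * (\<Prod>j\<in>S - {b} - {a}. L j)"
      using assms ab A(2) by (intro prod.remove) auto
    moreover have "S - {b} - {a} = S - A" using A(1) by auto
    ultimately have "(\<Prod>j\<in>S - A. L j) * (\<Prod>j\<in>S. L j) = (\<Prod>j\<in>S - {b}. L j) * (\<Prod>j\<in>S - {a}. L j)"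
      by (simp add: mult_ac)
    moreover have "z * (\<Prod>j\<in>S - {b}. L j) * (\<Prod>j\<in>S - {a}. L j) \<in> ideal_power ?I (Suc (Suc (2 * k)))"
      using Suc assms ab by (intro mult_in_ideal_power_Suc star_ideal_generator) (auto simp: z_def)
    ultimately show ?thesis by (simp add: mult.assoc)
  qed
  (* The empty sum needs its own argument: sums in an ideal product are binary,
     so 0 has to be exhibited as a product. *)
  have "(\<Sum>A\<in>B. z * ((\<Prod>j\<in>S - A. L j) * (\<Prod>j\<in>S. L j))) \<in> ideal_power ?I (Suc (Suc (2 * k)))"
    if "B \<subseteq> ?T" for B
    using finite_subset[OF that] that
  proof (induction B rule: infinite_finite_induct)
    case empty
    have "z * 0 * 0 \<in> ideal_power ?I (Suc (Suc (2 * k)))"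
      using Suc I0 by (intro mult_in_ideal_power_Suc) (auto simp: z_def)
    thus ?case by simp
  next
    case (insert A B)
    thus ?case using step by (auto intro!: add_in_ideal_power_Suc)
  qed (use assms in auto)
  from this[of ?T] show ?case
    by (simp add: z_def pair_omitting_sum_def sum_distrib_left sum_distrib_right mult_ac)
qed (simp add: ideal_power_0)

section \<open>Regularity of three lines through no common point\<close>

definition plane_var :: "3 \<Rightarrow> 'k::field plane_coord" where
  "plane_var i = Poly_Mapping.single (Poly_Mapping.single i 1) 1"

definition plane_const :: "'k::field \<Rightarrow> 'k plane_coord" where
  "plane_const c = Poly_Mapping.single 0 c"

lemma plane_const_mult: "plane_const (a * b) = plane_const a * plane_const b"
  by (simp add: plane_const_def mult_single)

lemma plane_const_add: "plane_const (a + b) = plane_const a + plane_const b"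
  by (simp add: plane_const_def single_add)

lemma plane_const_diff: "plane_const (a - b) = plane_const a - plane_const b"
  by (simp add: plane_const_def single_diff)

lemma plane_const_eq_0_iff: "plane_const c = 0 \<longleftrightarrow> c = 0"
  by (simp add: plane_const_def flip: keys_eq_empty)

lemma plane_const_0: "plane_const 0 = 0" and plane_const_1: "plane_const 1 = 1"
  by (simp_all add: plane_const_def)

lemma poly_mapping_eq_sum_single:
  fixes f :: "'a \<Rightarrow>\<^sub>0 'b::comm_monoid_add"
  shows
  "(\<Sum>t\<in>Poly_Mapping.keys f. Poly_Mapping.single t (Poly_Mapping.lookup f t)) = f"
proof (rule poly_mapping_eqI)
  fix s
  have "(\<Sum>t\<in>Poly_Mapping.keys f. Poly_Mapping.lookup f t when t = s) =
      (\<Sum>t\<in>Poly_Mapping.keys f. if t = s then Poly_Mapping.lookup f s else 0)"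
    by (intro sum.cong) (auto simp: when_def)
  also have "\<dots> = Poly_Mapping.lookup f s" by (simp add: in_keys_iff)
  finally show "Poly_Mapping.lookup (\<Sum>t\<in>Poly_Mapping.keys f.
      Poly_Mapping.single t (Poly_Mapping.lookup f t)) s = Poly_Mapping.lookup f s"
    by (simp add: lookup_sum lookup_single)
qed

lemma poly_mapping_single_add_induct:
  fixes f :: "'a \<Rightarrow>\<^sub>0 'b::comm_monoid_add"
  assumes "P 0" and "\<And>t c. P (Poly_Mapping.single t c)" and "\<And>f g. P f \<Longrightarrow> P g \<Longrightarrow> P (f + g)"
  shows "P f"
proof -
  have "P (\<Sum>t\<in>A. Poly_Mapping.single t (Poly_Mapping.lookup f t))" for A
    by (induction A rule: infinite_finite_induct) (use assms in auto)
  from this[of "Poly_Mapping.keys f"] show ?thesis by (simp only: poly_mapping_eq_sum_single)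
qed

text \<open>The \<open>K\<close>-algebra endomorphism with \<open>x\<^sub>i \<mapsto> y i\<close>; its multiplicativity is checked on monomials.\<close>

definition plane_subst :: "(3 \<Rightarrow> 'k::field plane_coord) \<Rightarrow> 'k plane_coord \<Rightarrow> 'k plane_coord" where
  "plane_subst y f = (\<Sum>t\<in>Poly_Mapping.keys f.
     plane_const (Poly_Mapping.lookup f t) * (\<Prod>i\<in>UNIV. y i ^ Poly_Mapping.lookup t i))"

lemma plane_subst_0: "plane_subst y 0 = 0"
  by (simp add: plane_subst_def)

lemma plane_subst_add: "plane_subst y (f + g) = plane_subst y f + plane_subst y g"
  unfolding plane_subst_def
  by (rule setsum_keys_plus_distrib[where f = "\<lambda>t c. plane_const c * (\<Prod>i\<in>UNIV. y i ^ Poly_Mapping.lookup t i)"])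
     (simp_all add: plane_const_0 plane_const_add distrib_right)

lemma plane_subst_single:
  "plane_subst y (Poly_Mapping.single t c) = plane_const c * (\<Prod>i\<in>UNIV. y i ^ Poly_Mapping.lookup t i)"
  by (cases "c = 0") (simp_all add: plane_subst_def plane_const_0)

lemma plane_subst_mult: "plane_subst y (f * g) = plane_subst y f * plane_subst y g"
proof (induction f rule: poly_mapping_single_add_induct)
  case (2 t c)
  show ?case
  proof (induction g rule: poly_mapping_single_add_induct)
    case (2 s d)
    show ?case
      by (simp add: mult_single plane_subst_single plane_const_mult lookup_add power_add prod.distrib mult_ac)
  qed (simp_all add: plane_subst_0 plane_subst_add distrib_left)
qed (simp_all add: plane_subst_0 plane_subst_add distrib_right)

lemma plane_subst_const: "plane_subst y (plane_const c) = plane_const c"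
  using plane_subst_single[of y 0 c] by (simp add: plane_const_def)

lemma plane_subst_var: "plane_subst y (plane_var i) = y i"
proof -
  have "(\<Prod>j\<in>UNIV. y j ^ Poly_Mapping.lookup (Poly_Mapping.single i 1) j) =
      (\<Prod>j\<in>UNIV. if j = i then y i else 1)"
    by (intro prod.cong) (auto simp: lookup_single)
  thus ?thesis by (simp add: plane_var_def plane_subst_single plane_const_1)
qed

lemma plane_subst_id: "plane_subst plane_var f = f"
proof (induction f rule: poly_mapping_single_add_induct)
  case (2 t c)
  have pow: "plane_var i ^ n = Poly_Mapping.single (Poly_Mapping.single i n) (1::'a)" for i n
    by (induction n) (simp_all add: plane_var_def mult_single flip: single_add)
  have "(\<Prod>i\<in>A. plane_var i ^ Poly_Mapping.lookup t i) =
      Poly_Mapping.single (\<Sum>i\<in>A. Poly_Mapping.single i (Poly_Mapping.lookup t i)) (1::'a)" for A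
    by (induction A rule: infinite_finite_induct) (simp_all add: pow mult_single)
  moreover have "(\<Sum>i\<in>UNIV. Poly_Mapping.single i (Poly_Mapping.lookup t i)) = t"
    by (subst (2) poly_mapping_eq_sum_single[of t, symmetric])
      (intro sum.mono_neutral_right, auto simp: in_keys_iff)
  ultimately show ?case by (simp add: plane_subst_single plane_const_def mult_single)
qed (simp_all add: plane_subst_0 plane_subst_add)

lemma pair_ideal_mult_cong:
  assumes "x - x' \<in> pair_ideal a b" "y - y' \<in> pair_ideal a b"
  shows "x * y - x' * y' \<in> pair_ideal a b"
proof -
  have "y * (x - x') + x' * (y - y') \<in> pair_ideal a b" using assms by (intro pair_ideal_add pair_ideal_mult)
  thus ?thesis by (simp add: algebra_simps)
qed

lemma plane_subst_cong_pair_ideal: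
  assumes "\<And>i. y i - z i \<in> pair_ideal a b"
  shows "plane_subst y f - plane_subst z f \<in> pair_ideal a b"
proof -
  have pow: "y i ^ n - z i ^ n \<in> pair_ideal a b" for i n
    by (induction n) (auto intro: pair_ideal_mult_cong assms pair_ideal_0)
  have "(\<Prod>i\<in>A. y i ^ n i) - (\<Prod>i\<in>A. z i ^ n i) \<in> pair_ideal a b" for A n
    by (induction A rule: infinite_finite_induct) (auto intro: pair_ideal_mult_cong pow pair_ideal_0)
  thus ?thesis unfolding plane_subst_def sum_subtractf[symmetric]
    by (intro pair_ideal_sum) (auto intro: pair_ideal_mult simp flip: right_diff_distrib)
qed

text \<open>The lines dual to the points \<open>(1 : t : t\<^sup>2)\<close> of a conic. No three points of a conic are collinear, so
no three of these lines are concurrent.\<close>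

definition moment_line :: "'k::field \<Rightarrow> 'k plane_coord" where
  "moment_line t = plane_var 0 + plane_const t * plane_var 1 + plane_const (t\<^sup>2) * plane_var 2"

lemma UNIV_3: "(UNIV :: 3 set) = {0, 1, 2}"
  by (rule card_subset_eq[symmetric]) auto

text \<open>The lines with parameters \<open>a\<close> and \<open>b\<close> meet at the point \<open>p = (a b : - (a + b) : 1)\<close>, whose
coordinates are the coefficients of \<open>(X - a) (X - b)\<close>. Substituting \<open>p\<^sub>i x\<^sub>2\<close> for \<open>x\<^sub>i\<close> kills both
lines, maps the line with parameter \<open>c\<close> to the nonzero form \<open>(c - a) (c - b) x\<^sub>2\<close>, and changes no
polynomial modulo the ideal of the two lines. Hence it kills \<open>g\<close>, which therefore lies in that ideal.\<close>

lemma moment_line_regular: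
  assumes "a \<noteq> b" "a \<noteq> c" "b \<noteq> c"
    and g: "moment_line c * g \<in> pair_ideal (moment_line a) (moment_line b)"
  shows "g \<in> pair_ideal (moment_line a) (moment_line b)"
proof -
  define y :: "3 \<Rightarrow> 'a plane_coord" where
    "y i = (if i = 0 then plane_const (a * b) else if i = 1 then - plane_const (a + b) else 1) * plane_var 2" for i
  have line: "plane_subst y (moment_line t) = plane_const ((t - a) * (t - b)) * plane_var 2" for t
    by (simp add: moment_line_def plane_subst_add plane_subst_mult plane_subst_const plane_subst_var y_def plane_const_add
        plane_const_mult plane_const_diff power2_eq_square algebra_simps)
  obtain p q where "moment_line c * g = p * moment_line a + q * moment_line b"
    using g by (auto simp: pair_ideal_def)
  hence "plane_subst y (moment_line c * g) = plane_subst y (p * moment_line a + q * moment_line b)" by simp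
  hence "plane_const ((c - a) * (c - b)) * plane_var 2 * plane_subst y g = 0"
    by (simp add: plane_subst_add plane_subst_mult line plane_const_0)
  moreover have "plane_const ((c - a) * (c - b)) \<noteq> 0"
    using assms(2,3) by (simp add: plane_const_eq_0_iff)
  moreover have "plane_var 2 \<noteq> (0 :: 'a plane_coord)" by (simp add: plane_var_def flip: keys_eq_empty)
  ultimately have "plane_subst y g = 0" by simp
  moreover have "plane_subst y g - plane_subst plane_var g \<in> pair_ideal (moment_line a) (moment_line b)"
  proof (rule plane_subst_cong_pair_ideal)
    fix i :: 3
    have "plane_const (inverse (a - b)) * plane_const (a - b) = 1"
      using \<open>a \<noteq> b\<close> by (simp add: plane_const_1 flip: plane_const_mult)
    hence "plane_var 1 + plane_const (a + b) * plane_var 2 =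
        plane_const (inverse (a - b)) * (plane_const (a - b) * (plane_var 1 + plane_const (a + b) * plane_var 2))"
      by (simp flip: mult.assoc)
    also have "\<dots> = plane_const (inverse (a - b)) * (moment_line a - moment_line b)"
      by (simp add: moment_line_def plane_const_add plane_const_mult plane_const_diff power2_eq_square algebra_simps)
    finally have 1: "plane_var 1 + plane_const (a + b) * plane_var 2 \<in> pair_ideal (moment_line a) (moment_line b)"
      by (simp add: pair_ideal_mult pair_ideal_diff pair_ideal_dvd1 pair_ideal_dvd2)
    have "plane_var 0 - plane_const (a * b) * plane_var 2 =
        moment_line a - plane_const a * (plane_var 1 + plane_const (a + b) * plane_var 2)"
      by (simp add: moment_line_def plane_const_add plane_const_mult power2_eq_square algebra_simps)
    also have "\<dots> \<in> pair_ideal (moment_line a) (moment_line b)"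
      using 1 by (intro pair_ideal_diff pair_ideal_mult) (auto intro: pair_ideal_dvd1)
    finally have 0: "plane_var 0 - plane_const (a * b) * plane_var 2 \<in> pair_ideal (moment_line a) (moment_line b)" .
    have "i \<in> {0, 1, 2}" using UNIV_3 by blast
    thus "y i - plane_var i \<in> pair_ideal (moment_line a) (moment_line b)"
      using pair_ideal_mult[OF 0, of "- 1"] pair_ideal_mult[OF 1, of "- 1"]
      by (auto simp: y_def pair_ideal_0 minus_diff_commute)
  qed
  ultimately have "0 - g \<in> pair_ideal (moment_line a) (moment_line b)" by (simp add: plane_subst_id)
  from pair_ideal_mult[OF this, of "- 1"] show ?thesis by simp
qed

section \<open>Degrees and orders of vanishing\<close>

definition homogeneous_of_degree :: "nat \<Rightarrow> 'k::field plane_coord \<Rightarrow> bool" where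
  "homogeneous_of_degree d f \<longleftrightarrow> (\<forall>t\<in>Poly_Mapping.keys f. total_degree t = d)"

text \<open>The \<open>d\<close>-th power of the irrelevant ideal \<open>(x\<^sub>0, x\<^sub>1, x\<^sub>2)\<close>, described by degrees.\<close>

definition order_ge :: "nat \<Rightarrow> 'k::field plane_coord set" where
  "order_ge d = {f. \<forall>t\<in>Poly_Mapping.keys f. d \<le> total_degree t}"

lemma total_degree_add: "total_degree (s + t) = total_degree s + total_degree t"
  by (simp add: total_degree_def lookup_add sum.distrib)

lemma order_ge_add: "f \<in> order_ge d \<Longrightarrow> g \<in> order_ge d \<Longrightarrow> f + g \<in> order_ge d"
  using keys_add[of f g] unfolding order_ge_def by blast

lemma order_ge_sum: "(\<And>i. i \<in> A \<Longrightarrow> f i \<in> order_ge d) \<Longrightarrow> sum f A \<in> order_ge d"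
  by (induction A rule: infinite_finite_induct) (simp_all add: order_ge_add, simp_all add: order_ge_def)

lemma order_ge_mult:
  assumes "f \<in> order_ge d" "g \<in> order_ge e"
  shows "f * g \<in> order_ge (d + e)"
  unfolding order_ge_def
proof safe
  fix t assume "t \<in> Poly_Mapping.keys (f * g)"
  then obtain a b where "t = a + b" "a \<in> Poly_Mapping.keys f" "b \<in> Poly_Mapping.keys g"
    using keys_mult[of f g] by blast
  thus "d + e \<le> total_degree t"
    using assms by (auto simp: order_ge_def total_degree_add intro: add_mono)
qed

lemma homogeneous_of_degree_mult:
  assumes "homogeneous_of_degree d f" "homogeneous_of_degree e g"
  shows "homogeneous_of_degree (d + e) (f * g)"
  unfolding homogeneous_of_degree_def
proof
  fix t assume "t \<in> Poly_Mapping.keys (f * g)"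
  then obtain a b where "t = a + b" "a \<in> Poly_Mapping.keys f" "b \<in> Poly_Mapping.keys g"
    using keys_mult[of f g] by blast
  thus "total_degree t = d + e"
    using assms by (auto simp: homogeneous_of_degree_def total_degree_add)
qed

lemma homogeneous_of_degree_add:
  "homogeneous_of_degree d f \<Longrightarrow> homogeneous_of_degree d g \<Longrightarrow> homogeneous_of_degree d (f + g)"
  using keys_add[of f g] unfolding homogeneous_of_degree_def by blast

lemma homogeneous_of_degree_1: "homogeneous_of_degree 0 1"
  by (simp add: homogeneous_of_degree_def total_degree_def)

lemma homogeneous_of_degree_moment_line: "homogeneous_of_degree 1 (moment_line t)"
proof -
  have "homogeneous_of_degree 1 (plane_const c * plane_var i)" for c :: 'a and i
    by (auto simp: homogeneous_of_degree_def plane_const_def plane_var_def mult_single total_degree_def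
        lookup_single when_def)
  hence "homogeneous_of_degree 1 (plane_const 1 * plane_var 0 + plane_const t * plane_var 1 + plane_const (t\<^sup>2) * plane_var 2)"
    by (intro homogeneous_of_degree_add)
  thus ?thesis by (simp add: moment_line_def plane_const_1)
qed

lemma homogeneous_of_degree_prod_moment_line:
  "homogeneous_of_degree (card T) (\<Prod>t\<in>T. moment_line t)"
  by (induction T rule: infinite_finite_induct)
    (simp_all add: homogeneous_of_degree_1
      homogeneous_of_degree_mult[OF homogeneous_of_degree_moment_line, simplified])

lemma homogeneous_of_degree_power:
  "homogeneous_of_degree d f \<Longrightarrow> homogeneous_of_degree (n * d) (f ^ n)"
  by (induction n) (simp_all add: homogeneous_of_degree_1 homogeneous_of_degree_mult)

lemma homogeneous_not_in_order_ge:
  assumes "homogeneous_of_degree d f" "f \<noteq> 0" "d < e"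
  shows "f \<notin> order_ge e"
proof -
  obtain t where "t \<in> Poly_Mapping.keys f" using assms(2) keys_eq_empty by blast
  thus ?thesis using assms(1,3) by (auto simp: homogeneous_of_degree_def order_ge_def)
qed

lemma moment_line_nonzero: "moment_line t \<noteq> (0 :: 'k::field plane_coord)"
proof
  assume "moment_line t = (0 :: 'k plane_coord)"
  (* Evaluation at (1 : 0 : 0), which lies on none of the lines. *)
  hence "plane_subst (\<lambda>i. if i = 0 then 1 else 0) (moment_line t) = 0" by (simp add: plane_subst_0)
  thus False by (simp add: moment_line_def plane_subst_add plane_subst_mult plane_subst_const plane_subst_var)
qed

text \<open>Over a finite field \<open>1 + \<Prod>(X - a)\<close> has no root.\<close>

lemma infinite_UNIV_alg_closed: "infinite (UNIV :: 'k::alg_closed_field set)"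
proof
  assume fin: "finite (UNIV :: 'k set)"
  define p :: "'k poly" where "p = (\<Prod>a\<in>UNIV. [:- a, 1:])"
  have "degree p = card (UNIV :: 'k set)"
    by (simp add: p_def degree_prod_sum_eq)
  hence "degree (p + 1) > 0"
    using fin by (simp add: degree_add_eq_left finite_UNIV_card_ge_0)
  then obtain x where "poly (p + 1) x = 0" using alg_closed_imp_poly_has_root by blast
  moreover have "poly p x = 0" using fin by (auto simp: p_def poly_prod)
  ultimately show False by simp
qed

section \<open>The star configuration of lines dual to points of a conic\<close>

lemma star_ideal_moment_line_order:
  assumes fin: "finite S"
  shows "star_ideal moment_line S \<subseteq> order_ge (card S - 1)"
proof -
  have "g * (\<Prod>j\<in>S - {i}. moment_line j) \<in> order_ge (card S - 1)" if "i \<in> S" for g i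
  proof -
    have "(\<Prod>j\<in>S - {i}. moment_line j) \<in> order_ge (card S - 1)"
      using homogeneous_of_degree_prod_moment_line[of "S - {i}"] that fin
      by (simp add: homogeneous_of_degree_def order_ge_def)
    from order_ge_mult[OF _ this, of g 0] show ?thesis by (simp add: order_ge_def)
  qed
  thus ?thesis unfolding star_ideal_def by (auto intro: order_ge_sum)
qed

lemma points_regular_moment_line: "points_regular moment_line S"
  unfolding points_regular_def using moment_line_regular by blast

lemma homogeneous_star_ideal_moment_line:
  fixes S :: "'k::field set"
  assumes fin: "finite S"
  shows "homogeneous_ideal (star_ideal moment_line S)"
  unfolding homogeneous_ideal_def
proof (intro exI conjI ballI)
  show "star_ideal moment_line S =
      Idl\<^bsub>ring_of_type_algebra\<^esub> ((\<lambda>i. \<Prod>j\<in>S - {i}. moment_line j) ` S)"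
    by (rule star_ideal_eq_genideal[OF fin])
  fix f :: "'k plane_coord"
  assume "f \<in> (\<lambda>i. \<Prod>j\<in>S - {i}. moment_line j) ` S"
  then obtain i where "f = (\<Prod>j\<in>S - {i}. moment_line j)" by blast
  thus "homogeneous_poly f"
    using homogeneous_of_degree_prod_moment_line[of "S - {i}"]
    unfolding homogeneous_poly_def homogeneous_of_degree_def by metis
qed

text \<open>The witness is the \<open>k\<close>-th power of the product of all lines: it has degree \<open>k s\<close> for \<open>s\<close> lines,
while everything in the \<open>r\<close>-th power of the star ideal has order at least \<open>r (s - 1)\<close>.\<close>

lemma star_ideal_noncontainment:
  fixes S :: "'k::field set"
  assumes two: "card S \<ge> 2" and less: "k * card S < r * (card S - 1)"
  shows "star_ideal moment_line S \<noteq> {0}" "star_ideal moment_line S \<noteq> UNIV"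
    "\<not> symbolic_power (star_ideal moment_line S) (2 * k) \<subseteq> ideal_power (star_ideal moment_line S) r"
proof -
  let ?I = "star_ideal moment_line S"
  let ?F = "\<Prod>t\<in>S. moment_line t"
  have ne: "S \<noteq> {}" using two by auto
  have fin: "finite S" using two by (intro card_ge_0_finite) simp
  obtain i where "i \<in> S" using ne by blast
  have "(\<Prod>t\<in>S - {i}. moment_line t) \<noteq> 0"
    using fin by (simp add: moment_line_nonzero)
  thus "?I \<noteq> {0}" using star_ideal_generator[OF fin \<open>i \<in> S\<close>, of moment_line] by auto
  have one: "1 \<notin> ?I"
  proof
    assume "1 \<in> ?I"
    hence "1 \<in> (order_ge (card S - 1) :: 'k plane_coord set)" by (rule subsetD[OF star_ideal_moment_line_order[OF fin]])
    thus False using homogeneous_not_in_order_ge[of 0 "1 :: 'k plane_coord" "card S - 1"]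
        homogeneous_of_degree_1 two by simp
  qed
  thus "?I \<noteq> UNIV" by blast
  have "?F ^ k \<in> symbolic_power ?I (2 * k)"
  proof (rule mult_in_symbolic_powerI)
    show "0 \<in> ?I" by (auto simp: star_ideal_def intro!: exI[of _ "\<lambda>_. 0"])
    show "pair_omitting_sum moment_line S ^ k * ?F ^ k \<in> ideal_power ?I (2 * k)"
      by (rule pair_omitting_sum_mult_prod_power[OF fin])
    show "g \<in> ?I" if "pair_omitting_sum moment_line S ^ k * g \<in> ?I" for g
      using pair_omitting_sum_power_regular[OF fin ne points_regular_moment_line that] .
  qed (rule one)
  moreover have "?F ^ k \<notin> order_ge (r * (card S - 1))"
    using homogeneous_of_degree_power[OF homogeneous_of_degree_prod_moment_line[of S], of k] less fin
    by (intro homogeneous_not_in_order_ge) (auto simp: moment_line_nonzero)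
  moreover have "ideal_power ?I r \<subseteq> order_ge (r * (card S - 1))"
    by (intro ideal_power_order_subset star_ideal_moment_line_order[OF fin] order_ge_add order_ge_mult)
      (auto simp: order_ge_def)
  ultimately show "\<not> symbolic_power ?I (2 * k) \<subseteq> ideal_power ?I r" by blast
qed

theorem corollary5p3:
  shows "\<not> (\<exists>c::real. c < 2 \<and>
    (\<forall>I :: 'k::alg_closed_field plane_coord set.
       homogeneous_ideal I \<and> I \<noteq> {0} \<and> I \<noteq> UNIV \<longrightarrow>
       (\<forall>m r :: nat. 0 < m \<and> 0 < r \<and> real m / real r \<ge> c \<longrightarrow>
          symbolic_power I m \<subseteq> ideal_power I r)))"
proof
  assume "\<exists>c::real. c < 2 \<and>
    (\<forall>I :: 'k::alg_closed_field plane_coord set.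
       homogeneous_ideal I \<and> I \<noteq> {0} \<and> I \<noteq> UNIV \<longrightarrow>
       (\<forall>m r :: nat. 0 < m \<and> 0 < r \<and> real m / real r \<ge> c \<longrightarrow>
          symbolic_power I m \<subseteq> ideal_power I r))"
  then obtain c :: real where c: "c < 2"
    and contain: "\<forall>I :: 'k plane_coord set.
       homogeneous_ideal I \<and> I \<noteq> {0} \<and> I \<noteq> UNIV \<longrightarrow>
       (\<forall>m r :: nat. 0 < m \<and> 0 < r \<and> real m / real r \<ge> c \<longrightarrow>
          symbolic_power I m \<subseteq> ideal_power I r)"
    by (elim exE conjE)
  obtain s0 :: nat where s0: "real s0 \<ge> 4 / (2 - c)" using real_arch_simple by blast
  define s where "s = max 3 s0"
  have s: "s \<ge> 3" "real s \<ge> 4 / (2 - c)" using s0 by (auto simp: s_def)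
  obtain S :: "'k set" where S: "finite S" "card S = s"
    using infinite_arbitrarily_large[OF infinite_UNIV_alg_closed] by blast
  (* With r = s and k = s - 2 the degrees compare as s (s - 2) < s (s - 1),
     and m / r = 2 k / r = 2 - 4 / s, which reaches c once s is at least 4 / (2 - c). *)
  have "(s - 2) * card S < s * (card S - 1)"
    using s S by (simp add: mult.commute)
  note nc = star_ideal_noncontainment[OF _ this]
  have "4 \<le> real s * (2 - c)" using s(2) c by (simp add: field_simps)
  hence "c * real s \<le> 2 * (real s - 2)" by (simp add: algebra_simps)
  hence "real (2 * (s - 2)) / real s \<ge> c" using s by (simp add: le_divide_eq of_nat_diff)
  hence "symbolic_power (star_ideal moment_line S) (2 * (s - 2)) \<subseteq>
      ideal_power (star_ideal moment_line S) s"
    using contain[rule_format, of "star_ideal moment_line S" "2 * (s - 2)" s]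
      homogeneous_star_ideal_moment_line[OF S(1)] nc(1,2) s S(2) by simp
  thus False using nc(3) s S(2) by simp
qed

end
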